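(* For each of the following four lattices: the quadratic lattice, the crossed quadratic lattice, the generalized aztec diamond lattice, and the 8.8.4 lattice, the entropy constant is the same whether the lattice is on the plane, the cylinder or the torus. That is, if $G_{m,n}$, $H_{n,m}$, $S_{n,m}$ denote the corresponding plane, cylindrical and toroidal lattice graphs and $i(\cdot)$ denotes the number of independent sets, then the limits $$\lim_{m,n\to\infty} i(G_{m,n})^{1/|V(G_{m,n})|},\qquad \lim_{m,n\to\infty} i(H_{n,m})^{1/|V(H_{n,m})|},\qquad \lim_{m,n\to\infty} i(S_{n,m})^{1/|V(S_{n,m})|}$$ exist and are equal.
   Context: Independent sets include the empty set; the limits are double limits with $m,n\to\infty$ independently. In each case $H_{n,m}$ is the quotient of $G_{m,n}$ identifying the leftmost column of vertices with the rightmost one, and $S_{n,m}$ is the quotient of $H_{n,m}$ identifying also the top row with the bottom row, as specified below. Multiple edges are irrelevant, and a vertex carrying a loop (possible only for small $m,n$) belongs to no independent set. Quadratic lattice: $G_{m,n}$ has vertices $(i,j)$, $0\le i\le m$, $0\le j\le n$, with $(i,j)$ adjacent to $(i',j')$ iff $|i-i'|+|j-j'|=1$. Crossed quadratic lattice: same vertices, with $(i,j)\ne(i',j')$ adjacent iff $|i-i'|\le 1$ and $|j-j'|\le 1$ (both diagonals added in each square). In both cases $H_{n,m}$ identifies $(i,0)\sim(i,n)$ for all $i$, and $S_{n,m}$ identifies in addition $(0,j)\sim(m,j)$ for all $j$. Generalized aztec diamond of order $m\times n$: $G_{m,n}$ has vertices $(x,y)$ with $1\le x\le 2m+1$, $1\le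 y\le 2n+1$, $x+y$ odd, with $(x,y)$ adjacent to $(x',y')$ iff $|x-x'|=|y-y'|=1$. $H_{n,m}$ identifies $(x,1)\sim(x,2n+1)$ for all $x$; $S_{n,m}$ identifies in addition $(1,y)\sim(2m+1,y)$ for all $y$. 8.8.4 lattice ($m,n\ge 2$): $G_{m,n}$ is built from squares (4-cycles) indexed by $(a,b)$, $1\le a\le m$, $1\le b\le n$, with vertices $U(a,b)$ (up, present iff $a\ge 2$), $D(a,b)$ (down, present iff $a\le m-1$), $L(a,b)$ (left, present iff $b\ge 2$), $R(a,b)$ (right, present iff $b\le n-1$). Edges: for each $(a,b)$, each of $U(a,b),D(a,b)$ is adjacent to each of $L(a,b),R(a,b)$ (when present); $D(a,b)$ is adjacent to $U(a+1,b)$; $R(a,b)$ is adjacent to $L(a,b+1)$. It has $4mn-2m-2n$ vertices. $H_{n,m}$ identifies $U(a,1)\sim U(a,n)$ and $D(a,1)\sim D(a,n)$ for all $a$; $S_{n,m}$ identifies in addition $L(1,b)\sim L(m,b)$ and $R(1,b)\sim R(m,b)$ for all $b$. *)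

theory Defs
  imports Complex_Main
begin

text \<open>Only the values of \<open>adj\<close> on \<open>verts\<close> are ever consulted. A vertex \<open>x\<close> with \<open>adj \<Gamma> x x\<close>
  carries a loop.\<close>

record 'a graph =
  verts :: "'a set"
  adj :: "'a \<Rightarrow> 'a \<Rightarrow> bool"

definition indep_sets :: "'a graph \<Rightarrow> 'a set set" where
  "indep_sets \<Gamma> = {I. I \<subseteq> verts \<Gamma> \<and> (\<forall>x\<in>I. \<forall>y\<in>I. \<not> adj \<Gamma> x y)}"

definition num_indep :: "'a graph \<Rightarrow> nat" where
  "num_indep \<Gamma> = card (indep_sets \<Gamma>)"

definition identification :: "'a set \<Rightarrow> ('a \<Rightarrow> 'a \<Rightarrow> bool) \<Rightarrow> ('a \<times> 'a) set" where
  "identification V r =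
     {(x, y). x \<in> V \<and> y \<in> V \<and> equivclp (\<lambda>u v. u \<in> V \<and> v \<in> V \<and> r u v) x y}"

definition quotient_graph :: "'a graph \<Rightarrow> ('a \<Rightarrow> 'a \<Rightarrow> bool) \<Rightarrow> 'a set graph" where
  "quotient_graph \<Gamma> r =
     \<lparr>verts = verts \<Gamma> // identification (verts \<Gamma>) r,
      adj = (\<lambda>A B. \<exists>x\<in>A. \<exists>y\<in>B. adj \<Gamma> x y)\<rparr>"

definition has_entropy_constant :: "(nat \<Rightarrow> nat \<Rightarrow> 'a graph) \<Rightarrow> real \<Rightarrow> bool" where
  "has_entropy_constant \<Gamma> c \<longleftrightarrow>
     ((\<lambda>(m, n). real (num_indep (\<Gamma> m n)) powr (1 / real (card (verts (\<Gamma> m n)))))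
        \<longlongrightarrow> c) (sequentially \<times>\<^sub>F sequentially)"


subsection \<open>Quadratic and crossed quadratic lattice\<close>

definition quad_plane :: "nat \<Rightarrow> nat \<Rightarrow> (nat \<times> nat) graph" where
  "quad_plane m n =
     \<lparr>verts = {0..m} \<times> {0..n},
      adj = (\<lambda>(i, j) (i', j'). \<bar>int i - int i'\<bar> + \<bar>int j - int j'\<bar> = 1)\<rparr>"

definition crossed_plane :: "nat \<Rightarrow> nat \<Rightarrow> (nat \<times> nat) graph" where
  "crossed_plane m n =
     \<lparr>verts = {0..m} \<times> {0..n},
      adj = (\<lambda>(i, j) (i', j').
        (i, j) \<noteq> (i', j') \<and> \<bar>int i - int i'\<bar> \<le> 1 \<and> \<bar>int j - int j'\<bar> \<le> 1)\<rparr>"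

definition quad_columns :: "nat \<Rightarrow> nat \<times> nat \<Rightarrow> nat \<times> nat \<Rightarrow> bool" where
  "quad_columns n u v \<longleftrightarrow> (\<exists>i. u = (i, 0) \<and> v = (i, n))"

definition quad_rows :: "nat \<Rightarrow> nat \<times> nat \<Rightarrow> nat \<times> nat \<Rightarrow> bool" where
  "quad_rows m u v \<longleftrightarrow> (\<exists>j. u = (0, j) \<and> v = (m, j))"

definition quad_cylinder :: "nat \<Rightarrow> nat \<Rightarrow> (nat \<times> nat) set graph" where
  "quad_cylinder m n = quotient_graph (quad_plane m n) (quad_columns n)"

definition quad_torus :: "nat \<Rightarrow> nat \<Rightarrow> (nat \<times> nat) set graph" where
  "quad_torus m n =
     quotient_graph (quad_plane m n) (\<lambda>u v. quad_columns n u v \<or> quad_rows m u v)"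

definition crossed_cylinder :: "nat \<Rightarrow> nat \<Rightarrow> (nat \<times> nat) set graph" where
  "crossed_cylinder m n = quotient_graph (crossed_plane m n) (quad_columns n)"

definition crossed_torus :: "nat \<Rightarrow> nat \<Rightarrow> (nat \<times> nat) set graph" where
  "crossed_torus m n =
     quotient_graph (crossed_plane m n) (\<lambda>u v. quad_columns n u v \<or> quad_rows m u v)"


subsection \<open>Generalized aztec diamond\<close>

definition aztec_plane :: "nat \<Rightarrow> nat \<Rightarrow> (nat \<times> nat) graph" where
  "aztec_plane m n =
     \<lparr>verts = {(x, y). 1 \<le> x \<and> x \<le> 2 * m + 1 \<and> 1 \<le> y \<and> y \<le> 2 * n + 1 \<and> odd (x + y)},
      adj = (\<lambda>(x, y) (x', y'). \<bar>int x - int x'\<bar> = 1 \<and> \<bar>int y - int y'\<bar> = 1)\<rparr>"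

definition aztec_columns :: "nat \<Rightarrow> nat \<times> nat \<Rightarrow> nat \<times> nat \<Rightarrow> bool" where
  "aztec_columns n u v \<longleftrightarrow> (\<exists>x. u = (x, 1) \<and> v = (x, 2 * n + 1))"

definition aztec_rows :: "nat \<Rightarrow> nat \<times> nat \<Rightarrow> nat \<times> nat \<Rightarrow> bool" where
  "aztec_rows m u v \<longleftrightarrow> (\<exists>y. u = (1, y) \<and> v = (2 * m + 1, y))"

definition aztec_cylinder :: "nat \<Rightarrow> nat \<Rightarrow> (nat \<times> nat) set graph" where
  "aztec_cylinder m n = quotient_graph (aztec_plane m n) (aztec_columns n)"

definition aztec_torus :: "nat \<Rightarrow> nat \<Rightarrow> (nat \<times> nat) set graph" where
  "aztec_torus m n =
     quotient_graph (aztec_plane m n) (\<lambda>u v. aztec_columns n u v \<or> aztec_rows m u v)"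


subsection \<open>8.8.4 lattice\<close>

text \<open>The lattice is meant for \<open>m, n \<ge> 2\<close>; smaller values do not affect the limits.\<close>

datatype oct_vertex = Up nat nat | Down nat nat | Left nat nat | Right nat nat

definition oct_verts :: "nat \<Rightarrow> nat \<Rightarrow> oct_vertex set" where
  "oct_verts m n =
     {Up a b | a b. 2 \<le> a \<and> a \<le> m \<and> 1 \<le> b \<and> b \<le> n} \<union>
     {Down a b | a b. 1 \<le> a \<and> a \<le> m - 1 \<and> 1 \<le> b \<and> b \<le> n} \<union>
     {Left a b | a b. 1 \<le> a \<and> a \<le> m \<and> 2 \<le> b \<and> b \<le> n} \<union>
     {Right a b | a b. 1 \<le> a \<and> a \<le> m \<and> 1 \<le> b \<and> b \<le> n - 1}"

definition oct_edge :: "oct_vertex \<Rightarrow> oct_vertex \<Rightarrow> bool" where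
  "oct_edge u v \<longleftrightarrow> (\<exists>a b.
     (u \<in> {Up a b, Down a b} \<and> v \<in> {Left a b, Right a b}) \<or>
     (u = Down a b \<and> v = Up (a + 1) b) \<or>
     (u = Right a b \<and> v = Left a (b + 1)))"

definition oct_plane :: "nat \<Rightarrow> nat \<Rightarrow> oct_vertex graph" where
  "oct_plane m n = \<lparr>verts = oct_verts m n, adj = symclp oct_edge\<rparr>"

definition oct_columns :: "nat \<Rightarrow> oct_vertex \<Rightarrow> oct_vertex \<Rightarrow> bool" where
  "oct_columns n u v \<longleftrightarrow>
     (\<exists>a. (u = Up a 1 \<and> v = Up a n) \<or> (u = Down a 1 \<and> v = Down a n))"

definition oct_rows :: "nat \<Rightarrow> oct_vertex \<Rightarrow> oct_vertex \<Rightarrow> bool" where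
  "oct_rows m u v \<longleftrightarrow>
     (\<exists>b. (u = Left 1 b \<and> v = Left m b) \<or> (u = Right 1 b \<and> v = Right m b))"

definition oct_cylinder :: "nat \<Rightarrow> nat \<Rightarrow> oct_vertex set graph" where
  "oct_cylinder m n = quotient_graph (oct_plane m n) (oct_columns n)"

definition oct_torus :: "nat \<Rightarrow> nat \<Rightarrow> oct_vertex set graph" where
  "oct_torus m n =
     quotient_graph (oct_plane m n) (\<lambda>u v. oct_columns n u v \<or> oct_rows m u v)"

end

theory Submission
  imports Defs
begin

text \<open>If a quotient only identifies vertices inside a set \<open>B\<close>, then the union of the members of an
  independent set of the quotient is independent in the original graph, and independent sets
  avoiding \<open>B\<close> survive in the quotient. So the logarithm of the number of independent sets changes
  by at most \<open>card B\<close>, which is of order \<open>m + n\<close> for the cylinder and the torus and hence negligible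
  against the number of vertices. The limit for the plane comes from Fekete's lemma in two indices:
  the logarithm is subadditive when a box of translated cells is cut in two.\<close>


section \<open>Counting independent sets under restriction, union and image of the vertex
  set\<close>

lemma finite_indep_sets: "finite (verts \<Gamma>) \<Longrightarrow> finite (indep_sets \<Gamma>)"
  by (rule finite_subset[of _ "Pow (verts \<Gamma>)"]) (auto simp: indep_sets_def)

lemma num_indep_pos:
  assumes "finite (verts \<Gamma>)"
  shows "0 < num_indep \<Gamma>"
proof -
  have "{} \<in> indep_sets \<Gamma>"
    by (simp add: indep_sets_def)
  with finite_indep_sets[OF assms] show ?thesis
    unfolding num_indep_def by (auto simp: card_gt_0_iff)
qed

lemma num_indep_le_power:
  assumes "finite (verts \<Gamma>)"
  shows "num_indep \<Gamma> \<le> 2 ^ card (verts \<Gamma>)"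
proof -
  have "card (indep_sets \<Gamma>) \<le> card (Pow (verts \<Gamma>))"
    by (rule card_mono) (auto simp: indep_sets_def assms)
  then show ?thesis
    by (simp add: num_indep_def card_Pow assms)
qed

lemma num_indep_mono:
  assumes "finite T" "S \<subseteq> T"
  shows "num_indep \<lparr>verts = S, adj = A\<rparr> \<le> num_indep \<lparr>verts = T, adj = A\<rparr>"
  unfolding num_indep_def
  by (rule card_mono[OF finite_indep_sets]) (use assms in \<open>auto simp: indep_sets_def\<close>)

text \<open>An independent set is determined by its traces on \<open>S\<close> and \<open>T\<close>,
  which are again independent. Edges between \<open>S\<close> and \<open>T\<close> are forgotten,
  whence only an inequality.\<close>

lemma num_indep_Un:
  assumes "finite S" "finite T"
  shows "num_indep \<lparr>verts = S \<union> T, adj = A\<rparr>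
    \<le> num_indep \<lparr>verts = S, adj = A\<rparr> * num_indep \<lparr>verts = T, adj = A\<rparr>"
proof -
  let ?X = "indep_sets \<lparr>verts = S, adj = A\<rparr> \<times> indep_sets \<lparr>verts = T, adj = A\<rparr>"
  have "card (indep_sets \<lparr>verts = S \<union> T, adj = A\<rparr>) \<le> card ?X"
  proof (rule card_inj_on_le)
    show "inj_on (\<lambda>I. (I \<inter> S, I \<inter> T)) (indep_sets \<lparr>verts = S \<union> T, adj = A\<rparr>)"
      by (rule inj_onI) (auto simp: indep_sets_def)
    show "finite ?X"
      using assms by (simp add: finite_indep_sets)
  qed (auto simp: indep_sets_def)
  then show ?thesis
    by (simp add: num_indep_def card_cartesian_product)
qed

text \<open>Independent sets are pulled back along \<open>f\<close>: an edge inside the preimage of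
  \<open>J\<close> would be mapped to an edge inside \<open>J\<close>, and \<open>J\<close> is
  recovered as the image of its preimage. Later \<open>f\<close> is a translation of boxes.\<close>

lemma num_indep_image_le:
  assumes "finite S" and hom: "\<And>u v. A u v \<Longrightarrow> A (f u) (f v)"
  shows "num_indep \<lparr>verts = f ` S, adj = A\<rparr> \<le> num_indep \<lparr>verts = S, adj = A\<rparr>"
  unfolding num_indep_def
proof (rule card_inj_on_le)
  show "inj_on (\<lambda>J. f -` J \<inter> S) (indep_sets \<lparr>verts = f ` S, adj = A\<rparr>)"
  proof (rule inj_on_inverseI)
    fix J assume "J \<in> indep_sets \<lparr>verts = f ` S, adj = A\<rparr>"
    then show "f ` (f -` J \<inter> S) = J"
      by (auto simp: indep_sets_def)
  qed
  show "finite (indep_sets \<lparr>verts = S, adj = A\<rparr>)"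
    by (simp add: assms finite_indep_sets)
qed (use hom in \<open>fastforce simp: indep_sets_def\<close>)

text \<open>Each vertex of \<open>S\<close> outside \<open>T\<close> at most doubles the count. This
  allows exchanging vertex sets that differ in few vertices.\<close>

lemma num_indep_le_diff:
  assumes "finite S" "finite T"
  shows "num_indep \<lparr>verts = S, adj = A\<rparr>
    \<le> num_indep \<lparr>verts = T, adj = A\<rparr> * 2 ^ card (S - T)"
proof -
  have "num_indep \<lparr>verts = S, adj = A\<rparr> \<le> num_indep \<lparr>verts = T \<union> (S - T), adj = A\<rparr>"
    using assms by (intro num_indep_mono) auto
  also have "\<dots> \<le> num_indep \<lparr>verts = T, adj = A\<rparr> * num_indep \<lparr>verts = S - T, adj = A\<rparr>"
    using assms by (intro num_indep_Un) auto
  also have "\<dots> \<le> num_indep \<lparr>verts = T, adj = A\<rparr> * 2 ^ card (S - T)"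
    using num_indep_le_power[of "\<lparr>verts = S - T, adj = A\<rparr>"] assms by simp
  finally show ?thesis .
qed

lemma ln_num_indep_le_diff:
  assumes "finite S" "finite T"
  shows "ln (real (num_indep \<lparr>verts = S, adj = A\<rparr>))
    \<le> ln (real (num_indep \<lparr>verts = T, adj = A\<rparr>)) + real (card (S - T))"
proof -
  let ?s = "real (num_indep \<lparr>verts = S, adj = A\<rparr>)"
  let ?t = "real (num_indep \<lparr>verts = T, adj = A\<rparr>)"
  have pos: "?s > 0" "?t > 0"
    using assms by (simp_all add: num_indep_pos)
  have "?s \<le> ?t * 2 ^ card (S - T)"
    using of_nat_mono[OF num_indep_le_diff[OF assms, of A], where 'a = real] by simp
  then have "ln ?s \<le> ln (?t * 2 ^ card (S - T))"
    using pos by simp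
  also have "\<dots> = ln ?t + real (card (S - T)) * ln 2"
    using pos by (simp add: ln_mult ln_realpow)
  \<comment> \<open>The factor \<open>ln 2\<close> is below 1 and is given away, so that errors
    become plain vertex counts.\<close>
  also have "\<dots> \<le> ln ?t + real (card (S - T)) * 1"
    using ln_2_less_1 by (intro add_left_mono mult_left_mono) auto
  finally show ?thesis by simp
qed


subsection \<open>Quotients\<close>

lemma equiv_identification: "equiv V (identification V r)"
proof (rule equivI)
  show "identification V r \<subseteq> V \<times> V"
    by (auto simp: identification_def)
  show "refl_on V (identification V r)"
    by (auto simp: refl_on_def identification_def)
  show "sym (identification V r)"
    by (auto simp: sym_def identification_def intro: equivclp_sym)
  show "trans (identification V r)"
    by (auto simp: trans_def identification_def intro: equivclp_trans)
qed

text \<open>A chain of identifications starting at \<open>x\<close> cannot take its first step,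
  because both ends of every step lie in \<open>B\<close>.\<close>

lemma identification_class_singleton:
  assumes supp: "\<And>u v. u \<in> V \<Longrightarrow> v \<in> V \<Longrightarrow> r u v \<Longrightarrow> u \<in> B \<and> v \<in> B"
    and x: "x \<in> V - B"
  shows "identification V r `` {x} = {x}"
proof -
  have "y = x" if "equivclp (\<lambda>u v. u \<in> V \<and> v \<in> V \<and> r u v) x y" for y
    using that
  proof (induction rule: equivclp_induct)
    case (step y z)
    then show ?case using supp x by blast
  qed simp
  then show ?thesis
    using x by (auto simp: identification_def)
qed

text \<open>The injection is \<open>Union\<close>. Classes are nonempty and pairwise disjoint, so a
  set of classes can be read off from its union. An edge inside the union would join two chosen
  classes or be a loop at one of them.\<close>

lemma num_indep_quotient_le:
  assumes fin: "finite (verts \<Gamma>)"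
  shows "num_indep (quotient_graph \<Gamma> r) \<le> num_indep \<Gamma>"
  unfolding num_indep_def
proof (rule card_inj_on_le)
  let ?R = "identification (verts \<Gamma>) r"
  have eq: "equiv (verts \<Gamma>) ?R"
    by (rule equiv_identification)
  have sub: "I \<subseteq> verts \<Gamma> // ?R" if "I \<in> indep_sets (quotient_graph \<Gamma> r)" for I
    using that by (auto simp: indep_sets_def quotient_graph_def)
  have le: "I \<subseteq> J" if IJ: "I \<subseteq> verts \<Gamma> // ?R" "J \<subseteq> verts \<Gamma> // ?R" "\<Union>I \<subseteq> \<Union>J" for I J
  proof
    fix X assume X: "X \<in> I"
    then have "X \<noteq> {}"
      using IJ(1) in_quotient_imp_non_empty[OF eq] by blast
    then obtain x where x: "x \<in> X" by blast
    then obtain Y where "Y \<in> J" "x \<in> Y"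
      using X IJ(3) by blast
    then have "X = Y"
      using quotient_disj[OF eq, of X Y] X x IJ(1,2) \<open>Y \<in> J\<close> \<open>x \<in> Y\<close> by blast
    with \<open>Y \<in> J\<close> show "X \<in> J" by simp
  qed
  show "inj_on Union (indep_sets (quotient_graph \<Gamma> r))"
  proof (rule inj_onI)
    fix I J assume "I \<in> indep_sets (quotient_graph \<Gamma> r)" "J \<in> indep_sets (quotient_graph \<Gamma> r)"
      and "\<Union>I = \<Union>J"
    then show "I = J"
      using le[OF sub sub, of I J] le[OF sub sub, of J I] by blast
  qed
  show "Union ` indep_sets (quotient_graph \<Gamma> r) \<subseteq> indep_sets \<Gamma>"
  proof clarify
    fix I assume I: "I \<in> indep_sets (quotient_graph \<Gamma> r)"
    have "\<Union>I \<subseteq> verts \<Gamma>"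
      using sub[OF I] in_quotient_imp_subset[OF eq] by blast
    then show "\<Union>I \<in> indep_sets \<Gamma>"
      using I by (fastforce simp: indep_sets_def quotient_graph_def)
  qed
  show "finite (indep_sets \<Gamma>)"
    by (rule finite_indep_sets[OF fin])
qed

lemma singleton_in_quotient:
  assumes "\<And>u v. u \<in> V \<Longrightarrow> v \<in> V \<Longrightarrow> r u v \<Longrightarrow> u \<in> B \<and> v \<in> B" "x \<in> V - B"
  shows "{x} \<in> V // identification V r"
  using identification_class_singleton[OF assms] quotientI[of x V "identification V r"] assms(2)
  by simp

lemma finite_verts_quotient:
  "finite (verts \<Gamma>) \<Longrightarrow> finite (verts (quotient_graph \<Gamma> r))"
  by (simp add: quotient_graph_def finite_quotient equiv_type[OF equiv_identification])

text \<open>Vertices outside \<open>B\<close> form singleton classes, and two singleton classes are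
  adjacent exactly when their elements are. So \<open>I\<close> is sent to the set of its
  singletons.\<close>

lemma num_indep_quotient_ge:
  assumes fin: "finite V"
    and supp: "\<And>u v. u \<in> V \<Longrightarrow> v \<in> V \<Longrightarrow> r u v \<Longrightarrow> u \<in> B \<and> v \<in> B"
  shows "num_indep \<lparr>verts = V - B, adj = A\<rparr> \<le> num_indep (quotient_graph \<lparr>verts = V, adj = A\<rparr> r)"
  unfolding num_indep_def
proof (rule card_inj_on_le)
  show "inj_on (\<lambda>I. (\<lambda>x. {x}) ` I) (indep_sets \<lparr>verts = V - B, adj = A\<rparr>)"
    by (rule inj_on_inverseI[where g = Union]) simp
  show "(\<lambda>I. (\<lambda>x. {x}) ` I) ` indep_sets \<lparr>verts = V - B, adj = A\<rparr>
    \<subseteq> indep_sets (quotient_graph \<lparr>verts = V, adj = A\<rparr> r)"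
    using singleton_in_quotient[of V r B, OF supp]
    by (auto simp: indep_sets_def quotient_graph_def)
  show "finite (indep_sets (quotient_graph \<lparr>verts = V, adj = A\<rparr> r))"
    by (intro finite_indep_sets finite_verts_quotient) (simp add: fin)
qed

lemma card_quotient_le:
  assumes "finite V"
  shows "card (verts (quotient_graph \<lparr>verts = V, adj = A\<rparr> r)) \<le> card V"
proof -
  have "V // identification V r = (\<lambda>x. identification V r `` {x}) ` V"
    by (auto simp: quotient_def)
  then show ?thesis
    by (simp add: quotient_graph_def card_image_le assms)
qed

lemma card_quotient_ge:
  assumes fin: "finite V"
    and supp: "\<And>u v. u \<in> V \<Longrightarrow> v \<in> V \<Longrightarrow> r u v \<Longrightarrow> u \<in> B \<and> v \<in> B"
  shows "card (V - B) \<le> card (verts (quotient_graph \<lparr>verts = V, adj = A\<rparr> r))"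
proof (rule card_inj_on_le)
  show "inj_on (\<lambda>x. {x}) (V - B)" by simp
  show "(\<lambda>x. {x}) ` (V - B) \<subseteq> verts (quotient_graph \<lparr>verts = V, adj = A\<rparr> r)"
    using singleton_in_quotient[of V r B, OF supp] by (auto simp: quotient_graph_def)
  show "finite (verts (quotient_graph \<lparr>verts = V, adj = A\<rparr> r))"
    by (rule finite_verts_quotient) (simp add: fin)
qed


subsection \<open>Limits in two indices\<close>

lemma subadditive_mult:
  fixes f :: "nat \<Rightarrow> real"
  assumes "\<And>a b. f (a + b) \<le> f a + f b" "f 0 \<le> 0"
  shows "f (k * a) \<le> real k * f a"
proof (induction k)
  case (Suc k)
  then show ?case
    using assms(1)[of a "k * a"] by (simp add: algebra_simps)
qed (simp add: assms)

text \<open>For positive \<open>m\<close> and \<open>n\<close> the quotient is \<open>c\<close>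
  times \<open>1 / n + 1 / m + 1 / (m * n)\<close>. The summand 1 in \<open>m + n + 1\<close> lets
  perimeter bounds of this form hold at \<open>m = n = 0\<close> too, where a plane lattice may
  still have a vertex.\<close>

lemma linear_over_area_tendsto_0:
  "((\<lambda>(m, n). c * real (m + n + 1) / (real m * real n)) \<longlongrightarrow> 0) (sequentially \<times>\<^sub>F sequentially)"
proof -
  have m: "((\<lambda>p. 1 / real (fst p)) \<longlongrightarrow> 0) (sequentially \<times>\<^sub>F sequentially)"
    by (rule filterlim_compose[OF lim_1_over_n])
      (simp add: filterlim_def filtermap_fst_prod_filter)
  have n: "((\<lambda>p. 1 / real (snd p)) \<longlongrightarrow> 0) (sequentially \<times>\<^sub>F sequentially)"
    by (rule filterlim_compose[OF lim_1_over_n])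
      (simp add: filterlim_def filtermap_snd_prod_filter)
  have "((\<lambda>p. c * (1 / real (snd p) + 1 / real (fst p) + 1 / real (fst p) * (1 / real (snd p))))
      \<longlongrightarrow> c * (0 + 0 + 0 * 0)) (sequentially \<times>\<^sub>F sequentially)"
    by (intro tendsto_intros m n)
  moreover have "\<forall>\<^sub>F p in sequentially \<times>\<^sub>F sequentially.
      c * (1 / real (snd p) + 1 / real (fst p) + 1 / real (fst p) * (1 / real (snd p)))
      = (case p of (m, n) \<Rightarrow> c * real (m + n + 1) / (real m * real n))"
    unfolding eventually_prod_sequentially
    by (rule exI[of _ 1]) (auto simp: field_simps)
  ultimately show ?thesis
    by (simp add: filterlim_cong)
qed

text \<open>Cutting an \<open>m \<times> n\<close> box into \<open>p \<times> q\<close> boxes leaves a margin of area at most \<open>p n + q m\<close>,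
  which is negligible against \<open>m n\<close>.\<close>

lemma fekete_two_indices:
  fixes F :: "nat \<Rightarrow> nat \<Rightarrow> real"
  assumes F0: "\<And>m n. 0 \<le> F m n"
    and subx: "\<And>a b n. F (a + b) n \<le> F a n + F b n"
    and suby: "\<And>m a b. F m (a + b) \<le> F m a + F m b"
    and bound: "\<And>m n. F m n \<le> K * real m * real n"
  shows "\<exists>L. ((\<lambda>(m, n). F m n / (real m * real n)) \<longlongrightarrow> L) (sequentially \<times>\<^sub>F sequentially)"
proof -
  define G where "G = (\<lambda>p. F (fst p) (snd p) / (real (fst p) * real (snd p)))"
  \<comment> \<open>Division by zero makes \<open>G\<close> vanish when an index is 0, so the
    infimum is taken over positive indices only.\<close>
  define P where "P = {p :: nat \<times> nat. fst p \<ge> 1 \<and> snd p \<ge> 1}"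
  define L where "L = Inf (G ` P)"
  have bdd: "bdd_below (G ` P)"
    by (rule bdd_belowI[of _ 0]) (auto simp: G_def F0)
  have "0 \<le> K"
    using F0[of 1 1] bound[of 1 1] by simp
  \<comment> \<open>The density of any box exceeds that of a fixed box \<open>(p, q)\<close> by at
    most an error that vanishes as \<open>m\<close> and \<open>n\<close> grow.\<close>
  have upper: "G (m, n) \<le> G (p, q) + K * real (p + q) * real (m + n + 1) / (real m * real n)"
    if pos: "m \<ge> 1" "n \<ge> 1" "p \<ge> 1" "q \<ge> 1" for m n p q
  proof -
    define a r b s where "a = m div p" and "r = m mod p" and "b = n div q" and "s = n mod q"
    have m: "m = a * p + r" and n: "n = b * q + s" and rs: "r \<le> p" "s \<le> q"
      using pos by (auto simp: a_def r_def b_def s_def less_imp_le)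
    \<comment> \<open>Degenerate boxes supply the base case that \<open>subadditive_mult\<close>
      asks for.\<close>
    have z: "F 0 y \<le> 0" "F x 0 \<le> 0" for x y
      using bound[of 0 y] bound[of x 0] by simp_all
    have "F m n \<le> F (a * p) n + F r n"
      using subx m by simp
    also have "F (a * p) n \<le> F (a * p) (b * q) + F (a * p) s"
      using suby n by simp
    also have "F (a * p) (b * q) \<le> real a * F p (b * q)"
      by (rule subadditive_mult[of "\<lambda>x. F x (b * q)"]) (use subx z in auto)
    also have "F p (b * q) \<le> real b * F p q"
      by (rule subadditive_mult[of "F p"]) (use suby z in auto)
    also have "F (a * p) s \<le> K * real m * real q"
      using bound[of "a * p" s] mult_mono[of "real (a * p)" "real m" "real s" "real q"]
        mult_left_mono[OF _ \<open>0 \<le> K\<close>] m rs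
      by (smt (verit) mult.assoc of_nat_0_le_iff of_nat_mono le_add1)
    also have "F r n \<le> K * real p * real n"
      using bound[of r n] mult_mono[of "real r" "real p" "real n" "real n"]
        mult_left_mono[OF _ \<open>0 \<le> K\<close>] rs
      by (smt (verit) mult.assoc of_nat_0_le_iff of_nat_mono)
    finally have "F m n \<le> real a * (real b * F p q) + K * real m * real q + K * real p * real n"
      by (simp add: mult_left_mono)
    \<comment> \<open>The tiled sides \<open>a * p\<close> and \<open>b * q\<close> are enlarged to
      \<open>m\<close> and \<open>n\<close>, which is sound because \<open>G\<close> is
      nonnegative.\<close>
    moreover have "real a * (real b * F p q) \<le> real m * real n * G (p, q)"
    proof -
      have "real a * (real b * F p q) = real (a * p) * real (b * q) * G (p, q)"
        using pos by (simp add: G_def)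
      also have "\<dots> \<le> real m * real n * G (p, q)"
      proof (intro mult_right_mono mult_mono)
        show "real (a * p) \<le> real m" "real (b * q) \<le> real n"
          by (subst of_nat_le_iff, use m n in linarith)+
      qed (auto simp: G_def F0)
      finally show ?thesis .
    qed
    \<comment> \<open>The two margins are weakened to the shape treated by
      \<open>linear_over_area_tendsto_0\<close>.\<close>
    moreover have "K * real m * real q + K * real p * real n \<le> K * real (p + q) * real (m + n + 1)"
    proof -
      have "K * (real m * real q + real p * real n) \<le> K * (real (p + q) * real (m + n + 1))"
        by (rule mult_left_mono[OF _ \<open>0 \<le> K\<close>]) (simp add: algebra_simps)
      then show ?thesis by (simp add: algebra_simps)
    qed
    ultimately have "F m n \<le> real m * real n * G (p, q) + K * real (p + q) * real (m + n + 1)"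
      by linarith
    then show ?thesis
      using pos by (simp add: G_def field_simps)
  qed
  have "(G \<longlongrightarrow> L) (sequentially \<times>\<^sub>F sequentially)"
  proof (rule order_tendstoI)
    fix y assume "y < L"
    have "y < G (m, n)" if "m \<ge> 1" "n \<ge> 1" for m n
      using cINF_lower[OF bdd, of "(m, n)"] that \<open>y < L\<close> by (simp add: L_def P_def)
    then show "\<forall>\<^sub>F x in sequentially \<times>\<^sub>F sequentially. y < G x"
      unfolding eventually_prod_sequentially by blast
  next
    fix y assume "L < y"
    have "P \<noteq> {}" by (auto simp: P_def)
    \<comment> \<open>A box with density already below \<open>y\<close>; \<open>upper\<close>
      carries the bound over to all large boxes.\<close>
    then obtain p q where pq: "p \<ge> 1" "q \<ge> 1" "G (p, q) < y"
      using \<open>L < y\<close> bdd unfolding L_def by (auto simp: cINF_less_iff P_def)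
    have "\<forall>\<^sub>F x in sequentially \<times>\<^sub>F sequentially.
        (case x of (m, n) \<Rightarrow> K * real (p + q) * real (m + n + 1) / (real m * real n)) < y - G (p, q)"
      using pq by (intro order_tendstoD(2)[OF linear_over_area_tendsto_0]) simp
    then obtain N where N: "\<And>m n. m \<ge> N \<Longrightarrow> n \<ge> N \<Longrightarrow>
        K * real (p + q) * real (m + n + 1) / (real m * real n) < y - G (p, q)"
      unfolding eventually_prod_sequentially by auto
    have "G (m, n) < y" if "m \<ge> max N 1" "n \<ge> max N 1" for m n
      using upper[of m n p q] N[of m n] that pq by simp
    then show "\<forall>\<^sub>F x in sequentially \<times>\<^sub>F sequentially. G x < y"
      unfolding eventually_prod_sequentially by blast
  qed
  then show ?thesis
    by (auto simp: G_def case_prod_beta')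
qed

text \<open>An error of perimeter order disappears after division by the area.\<close>

lemma tendsto_area_cong:
  fixes f g :: "nat \<Rightarrow> nat \<Rightarrow> real"
  assumes g: "((\<lambda>(m, n). g m n / (real m * real n)) \<longlongrightarrow> L) (sequentially \<times>\<^sub>F sequentially)"
    and diff: "\<And>m n. \<bar>f m n - g m n\<bar> \<le> c * real (m + n + 1)"
  shows "((\<lambda>(m, n). f m n / (real m * real n)) \<longlongrightarrow> L) (sequentially \<times>\<^sub>F sequentially)"
proof -
  \<comment> \<open>The later comparison is between absolute values and the sign of \<open>c\<close>
    is unspecified, hence the absolute value of \<open>c\<close>.\<close>
  have bound: "\<bar>f m n - g m n\<bar> \<le> \<bar>c\<bar> * (1 + (real m + real n))" for m n
    using order_trans[OF diff[of m n] mult_right_mono[OF abs_ge_self of_nat_0_le_iff]]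
    by (simp add: add_ac)
  have "((\<lambda>(m, n). (f m n - g m n) / (real m * real n)) \<longlongrightarrow> 0) (sequentially \<times>\<^sub>F sequentially)"
    by (rule tendsto_0_le[OF linear_over_area_tendsto_0[of c], where K = 1])
      (auto intro!: always_eventually divide_right_mono simp: abs_mult bound)
  from tendsto_add[OF this g] show ?thesis
    by (simp add: case_prod_beta' diff_divide_distrib)
qed

text \<open>Write \<open>N powr (1 / V)\<close> as \<open>exp (ln N / V)\<close> and divide
  numerator and denominator by the area \<open>m * n\<close>: they tend to \<open>L\<close> and to
  \<open>k\<close>, the number of vertices per unit area.\<close>

lemma has_entropy_constant_if_area:
  fixes \<Gamma> :: "nat \<Rightarrow> nat \<Rightarrow> 'a graph"
  assumes F: "((\<lambda>(m, n). F m n / (real m * real n)) \<longlongrightarrow> L) (sequentially \<times>\<^sub>F sequentially)"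
    and "k > 0"
    and fin: "\<And>m n. finite (verts (\<Gamma> m n))"
    and num: "\<And>m n. \<bar>ln (real (num_indep (\<Gamma> m n))) - F m n\<bar> \<le> c * real (m + n + 1)"
    and card: "\<And>m n. \<bar>real (card (verts (\<Gamma> m n))) - k * real m * real n\<bar> \<le> d * real (m + n + 1)"
  shows "has_entropy_constant \<Gamma> (exp (L / k))"
proof -
  let ?S = "sequentially \<times>\<^sub>F sequentially :: (nat \<times> nat) filter"
  let ?N = "\<lambda>m n. real (num_indep (\<Gamma> m n))" and ?V = "\<lambda>m n. real (card (verts (\<Gamma> m n)))"
  have pos: "\<forall>\<^sub>F p in ?S. fst p \<ge> 1 \<and> snd p \<ge> 1"
    unfolding eventually_prod_sequentially by auto
  have lnN: "((\<lambda>(m, n). ln (?N m n) / (real m * real n)) \<longlongrightarrow> L) ?S"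
    by (rule tendsto_area_cong[OF F num])
  have "((\<lambda>(m, n). k * real m * real n / (real m * real n)) \<longlongrightarrow> k) ?S"
    by (rule tendsto_eventually) (use pos in eventually_elim, auto)
  then have V: "((\<lambda>(m, n). ?V m n / (real m * real n)) \<longlongrightarrow> k) ?S"
    by (rule tendsto_area_cong[OF _ card])
  have "((\<lambda>p. exp ((case p of (m, n) \<Rightarrow> ln (?N m n) / (real m * real n))
      / (case p of (m, n) \<Rightarrow> ?V m n / (real m * real n)))) \<longlongrightarrow> exp (L / k)) ?S"
    using \<open>k > 0\<close> by (intro tendsto_exp tendsto_divide lnN V) simp
  moreover have "\<forall>\<^sub>F p in ?S. exp ((case p of (m, n) \<Rightarrow> ln (?N m n) / (real m * real n))
      / (case p of (m, n) \<Rightarrow> ?V m n / (real m * real n)))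
      = (case p of (m, n) \<Rightarrow> ?N m n powr (1 / ?V m n))"
    using pos
  proof eventually_elim
    case (elim p)
    obtain m n where p: "p = (m, n)" by (cases p)
    \<comment> \<open>Since \<open>powr\<close> has the default value 0 at base 0, the exponential
      form needs a nonzero count.\<close>
    have "num_indep (\<Gamma> m n) \<noteq> 0"
      using num_indep_pos[OF fin[of m n]] by simp
    then show ?case
      using elim by (simp add: p powr_def)
  qed
  ultimately show ?thesis
    unfolding has_entropy_constant_def by (simp add: filterlim_cong)
qed


subsection \<open>Lattices built from translated cells\<close>

text \<open>The boxes \<open>W\<close> are idealised: they have exactly \<open>k * m * n\<close>
  vertices and are covered by a smaller box and a translate (\<open>sx\<close>, \<open>sy\<close>)
  of another, so Fekete's lemma applies to them. The actual vertex sets \<open>V\<close> differ from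
  \<open>W\<close> by perimeter order, and \<open>B\<close> contains all vertices touched by an
  identification. As \<open>r1\<close> (cylinder) implies \<open>r2\<close> (torus), one
  \<open>B\<close> serves both.\<close>

lemma lattice_entropy_constants:
  fixes A :: "'a \<Rightarrow> 'a \<Rightarrow> bool" and W V B :: "nat \<Rightarrow> nat \<Rightarrow> 'a set" and k C :: nat
  assumes finW: "\<And>m n. finite (W m n)" and cardW: "\<And>m n. card (W m n) = k * m * n" and "k > 0"
    and Wx: "\<And>a b n. W (a + b) n \<subseteq> W a n \<union> sx a ` W b n"
    and Wy: "\<And>m a b. W m (a + b) \<subseteq> W m a \<union> sy a ` W m b"
    and sx: "\<And>a u v. A u v \<Longrightarrow> A (sx a u) (sx a v)"
    and sy: "\<And>a u v. A u v \<Longrightarrow> A (sy a u) (sy a v)"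
    and finV: "\<And>m n. finite (V m n)"
    and VW: "\<And>m n. card (V m n - W m n) \<le> C * (m + n + 1)"
    and WV: "\<And>m n. card (W m n - V m n) \<le> C * (m + n + 1)"
    and finB: "\<And>m n. finite (B m n)" and cardB: "\<And>m n. card (B m n) \<le> C * (m + n + 1)"
    and r2: "\<And>m n u v. u \<in> V m n \<Longrightarrow> v \<in> V m n \<Longrightarrow> r2 m n u v \<Longrightarrow> u \<in> B m n \<and> v \<in> B m n"
    and r1: "\<And>m n u v. r1 m n u v \<Longrightarrow> r2 m n u v"
  shows "\<exists>c. has_entropy_constant (\<lambda>m n. \<lparr>verts = V m n, adj = A\<rparr>) c \<and>
    has_entropy_constant (\<lambda>m n. quotient_graph \<lparr>verts = V m n, adj = A\<rparr> (r1 m n)) c \<and>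
    has_entropy_constant (\<lambda>m n. quotient_graph \<lparr>verts = V m n, adj = A\<rparr> (r2 m n)) c"
proof -
  let ?ln = "\<lambda>S. ln (real (num_indep \<lparr>verts = S, adj = A\<rparr>))"
  have lnmono: "?ln S \<le> ?ln T" if "finite T" "S \<subseteq> T" for S T
    using num_indep_mono[OF that, of A] num_indep_pos[of "\<lparr>verts = S, adj = A\<rparr>"]
      finite_subset[OF that(2,1)] by simp
  have subadd: "?ln S \<le> ?ln T + ?ln U"
    if "finite T" "finite U" "S \<subseteq> T \<union> f ` U" "\<And>u v. A u v \<Longrightarrow> A (f u) (f v)" for S T U f
  proof -
    have "num_indep \<lparr>verts = S, adj = A\<rparr> \<le> num_indep \<lparr>verts = T \<union> f ` U, adj = A\<rparr>"
      using that by (intro num_indep_mono) auto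
    also have "\<dots> \<le> num_indep \<lparr>verts = T, adj = A\<rparr> * num_indep \<lparr>verts = f ` U, adj = A\<rparr>"
      using that by (intro num_indep_Un) auto
    also have "\<dots> \<le> num_indep \<lparr>verts = T, adj = A\<rparr> * num_indep \<lparr>verts = U, adj = A\<rparr>"
      using that by (intro mult_left_mono num_indep_image_le) auto
    finally have "real (num_indep \<lparr>verts = S, adj = A\<rparr>) \<le>
        real (num_indep \<lparr>verts = T, adj = A\<rparr>) * real (num_indep \<lparr>verts = U, adj = A\<rparr>)"
      unfolding of_nat_mult[symmetric] of_nat_le_iff .
    moreover have "finite S"
      using that finite_subset by blast
    ultimately have "?ln S \<le> ln (real (num_indep \<lparr>verts = T, adj = A\<rparr>) *
        real (num_indep \<lparr>verts = U, adj = A\<rparr>))"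
      using that num_indep_pos[of "\<lparr>verts = S, adj = A\<rparr>"] by (intro ln_mono) auto
    then show ?thesis
      using that num_indep_pos[of "\<lparr>verts = T, adj = A\<rparr>"] num_indep_pos[of "\<lparr>verts = U, adj = A\<rparr>"]
      by (simp add: ln_mult)
  qed
  \<comment> \<open>The empty graph has one independent set. Comparison with it yields both the
    nonnegativity and the area bound required by \<open>fekete_two_indices\<close>.\<close>
  have "indep_sets \<lparr>verts = {}, adj = A\<rparr> = {{}}"
    by (auto simp: indep_sets_def)
  then have empty: "?ln {} = 0"
    by (simp add: num_indep_def)
  have "\<exists>L. ((\<lambda>(m, n). ?ln (W m n) / (real m * real n)) \<longlongrightarrow> L) (sequentially \<times>\<^sub>F sequentially)"
  proof (rule fekete_two_indices)
    show "0 \<le> ?ln (W m n)" for m n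
      using lnmono[of "W m n" "{}"] finW empty by simp
    show "?ln (W (a + b) n) \<le> ?ln (W a n) + ?ln (W b n)" for a b n
      by (rule subadd[OF finW finW Wx sx])
    show "?ln (W m (a + b)) \<le> ?ln (W m a) + ?ln (W m b)" for m a b
      by (rule subadd[OF finW finW Wy sy])
    show "?ln (W m n) \<le> real k * real m * real n" for m n
      using ln_num_indep_le_diff[OF finW[of m n] finite.emptyI, of A] empty cardW[of m n] by simp
  qed
  then obtain L where L: "((\<lambda>(m, n). ?ln (W m n) / (real m * real n)) \<longlongrightarrow> L)
      (sequentially \<times>\<^sub>F sequentially)" by blast
  have numV: "\<bar>?ln (V m n) - ?ln (W m n)\<bar> \<le> real (C * (m + n + 1))" for m n
    using ln_num_indep_le_diff[OF finV[of m n] finW[of m n], of A]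
      ln_num_indep_le_diff[OF finW[of m n] finV[of m n], of A]
      of_nat_mono[OF VW[of m n], where 'a = real] of_nat_mono[OF WV[of m n], where 'a = real]
    by linarith
  \<comment> \<open>Both cardinalities are compared with that of the common part of
    \<open>V m n\<close> and \<open>W m n\<close>.\<close>
  have cardV: "\<bar>real (card (V m n)) - real k * real m * real n\<bar> \<le> real (C * (m + n + 1))" for m n
  proof -
    have "card (V m n) = card (V m n - W m n) + card (V m n \<inter> W m n)"
      "card (W m n) = card (W m n - V m n) + card (V m n \<inter> W m n)"
      using card_Int_Diff[OF finV[of m n], of "W m n"] card_Int_Diff[OF finW[of m n], of "V m n"]
      by (simp_all add: Int_commute)
    moreover have "real (card (W m n)) = real k * real m * real n"
      by (simp add: cardW)
    ultimately show ?thesis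
      using of_nat_mono[OF VW[of m n], where 'a = real] of_nat_mono[OF WV[of m n], where 'a = real]
      by linarith
  qed
  have plane: "has_entropy_constant (\<lambda>m n. \<lparr>verts = V m n, adj = A\<rparr>) (exp (L / real k))"
    by (rule has_entropy_constant_if_area[OF L, where c = C and d = C])
      (use \<open>k > 0\<close> finV numV[unfolded of_nat_mult] cardV[unfolded of_nat_mult] in simp_all)
  \<comment> \<open>Stated for a general relation \<open>r\<close>, to be used for the cylinder and
    for the torus.\<close>
  have quot: "has_entropy_constant (\<lambda>m n. quotient_graph \<lparr>verts = V m n, adj = A\<rparr> (r m n)) (exp (L / real k))"
    if r: "\<And>m n u v. u \<in> V m n \<Longrightarrow> v \<in> V m n \<Longrightarrow> r m n u v \<Longrightarrow> u \<in> B m n \<and> v \<in> B m n" for r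
  proof (rule has_entropy_constant_if_area[OF L])
    fix m n
    let ?Q = "quotient_graph \<lparr>verts = V m n, adj = A\<rparr> (r m n)"
    show finQ: "finite (verts ?Q)"
      by (rule finite_verts_quotient) (simp add: finV)
    have B': "card (V m n - (V m n - B m n)) \<le> C * (m + n + 1)"
      by (rule order_trans[OF card_mono[OF finB[of m n]] cardB]) blast
    have "ln (real (num_indep ?Q)) \<le> ?ln (V m n)"
      using num_indep_quotient_le[of "\<lparr>verts = V m n, adj = A\<rparr>" "r m n"] num_indep_pos[OF finQ] finV
      by simp
    moreover have "?ln (V m n - B m n) \<le> ln (real (num_indep ?Q))"
      using num_indep_quotient_ge[of "V m n" "r m n" "B m n", OF finV r, of A] finV
        num_indep_pos[of "\<lparr>verts = V m n - B m n, adj = A\<rparr>"] by simp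
    moreover have "?ln (V m n) \<le> ?ln (V m n - B m n) + real (C * (m + n + 1))"
      using ln_num_indep_le_diff[of "V m n" "V m n - B m n" A] finV B'
      by (smt (verit) finite_Diff of_nat_mono)
    \<comment> \<open>One \<open>C\<close> pays for passing from \<open>W\<close> to
      \<open>V\<close>, the other for deleting \<open>B\<close>.\<close>
    ultimately show "\<bar>ln (real (num_indep ?Q)) - ?ln (W m n)\<bar> \<le> real (2 * C) * real (m + n + 1)"
      using numV[of m n] by (simp add: algebra_simps)
    have "card (verts ?Q) \<le> card (V m n)"
      by (rule card_quotient_le[OF finV])
    moreover have "card (V m n - B m n) \<le> card (verts ?Q)"
      by (rule card_quotient_ge[OF finV r])
    moreover have "card (V m n) \<le> card (V m n - B m n) + C * (m + n + 1)"
      using diff_card_le_card_Diff[OF finB[of m n], of "V m n"] cardB[of m n] by linarith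
    ultimately show "\<bar>real (card (verts ?Q)) - real k * real m * real n\<bar> \<le> real (2 * C) * real (m + n + 1)"
      using cardV[of m n] of_nat_mono[of "card (V m n)" "card (V m n - B m n) + C * (m + n + 1)", where 'a = real]
      by (simp add: algebra_simps)
  qed (use \<open>k > 0\<close> in simp)
  show ?thesis
    using plane quot[of r1] quot[of r2] r1 r2 by blast
qed

section \<open>The quadratic and the crossed quadratic lattice\<close>

lemma card_frame_le:
  "card ({a, b} \<times> Y \<union> X \<times> {c, d}) \<le> 2 * card Y + 2 * card X"
proof -
  \<comment> \<open>Only inequalities, since opposite sides coincide when \<open>a = b\<close> or
    \<open>c = d\<close>.\<close>
  have "card ({a, b} \<times> Y) \<le> 2 * card Y" "card (X \<times> {c, d}) \<le> card X * 2"
    by (simp_all add: card_cartesian_product card_insert_if)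
  then show ?thesis
    using card_Un_le[of "{a, b} \<times> Y" "X \<times> {c, d}"] by linarith
qed

text \<open>The two lattices share vertices and identifications and differ only in \<open>A\<close>,
  of which translation invariance is all that matters.\<close>

lemma quad_shape_entropy_constants:
  fixes A :: "nat \<times> nat \<Rightarrow> nat \<times> nat \<Rightarrow> bool"
  assumes inv: "\<And>a b u v. A u v \<Longrightarrow> A (map_prod ((+) a) ((+) b) u) (map_prod ((+) a) ((+) b) v)"
  shows "\<exists>c. has_entropy_constant (\<lambda>m n. \<lparr>verts = {0..m} \<times> {0..n}, adj = A\<rparr>) c \<and>
    has_entropy_constant (\<lambda>m n. quotient_graph \<lparr>verts = {0..m} \<times> {0..n}, adj = A\<rparr>
      (quad_columns n)) c \<and>
    has_entropy_constant (\<lambda>m n. quotient_graph \<lparr>verts = {0..m} \<times> {0..n}, adj = A\<rparr>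
      (\<lambda>u v. quad_columns n u v \<or> quad_rows m u v)) c"
\<comment> \<open>Dropping the last row and column leaves exactly \<open>m * n\<close> vertices, and
  these boxes tile. \<open>B\<close> is the frame of the rectangle, with at most
  \<open>2 * (n + 1) + 2 * (m + 1)\<close> vertices, hence \<open>C = 4\<close>. The maps
  \<open>(+) 0\<close> make the translations instances of \<open>inv\<close>.\<close>
proof (rule lattice_entropy_constants[where k = 1 and C = 4
      and W = "\<lambda>m n. {..<m} \<times> {..<n}" and B = "\<lambda>m n. {0, m} \<times> {0..n} \<union> {0..m} \<times> {0, n}"
      and sx = "\<lambda>a. map_prod ((+) a) ((+) 0)" and sy = "\<lambda>a. map_prod ((+) 0) ((+) a)"])
  show "{..<a + b} \<times> {..<n} \<subseteq> {..<a} \<times> {..<n} \<union> map_prod ((+) a) ((+) 0) ` ({..<b} \<times> {..<n})" for a b n :: nat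
  proof
    fix v assume "v \<in> {..<a + b} \<times> {..<n}"
    then show "v \<in> {..<a} \<times> {..<n} \<union> map_prod ((+) a) ((+) 0) ` ({..<b} \<times> {..<n})"
      by (cases "fst v < a") (auto intro!: rev_image_eqI[of "(fst v - a, snd v)"])
  qed
  show "{..<m} \<times> {..<a + b} \<subseteq> {..<m} \<times> {..<a} \<union> map_prod ((+) 0) ((+) a) ` ({..<m} \<times> {..<b})" for m a b :: nat
  proof
    fix v assume "v \<in> {..<m} \<times> {..<a + b}"
    then show "v \<in> {..<m} \<times> {..<a} \<union> map_prod ((+) 0) ((+) a) ` ({..<m} \<times> {..<b})"
      by (cases "snd v < a") (auto intro!: rev_image_eqI[of "(fst v, snd v - a)"])
  qed
  fix m n :: nat
  show B: "card ({0, m} \<times> {0..n} \<union> {0..m} \<times> {0, n}) \<le> 4 * (m + n + 1)"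
    using card_frame_le[of 0 m "{0..n}" "{0..m}" 0 n] by simp
  \<comment> \<open>The dropped vertices have first coordinate \<open>m\<close> or second coordinate
    \<open>n\<close>, so they lie on the frame.\<close>
  have "card ({0..m} \<times> {0..n} - {..<m} \<times> {..<n}) \<le> card ({0, m} \<times> {0..n} \<union> {0..m} \<times> {0, n})"
    by (rule card_mono) auto
  with B show "card ({0..m} \<times> {0..n} - {..<m} \<times> {..<n}) \<le> 4 * (m + n + 1)" by linarith
  have empty: "{..<m} \<times> {..<n} - {0..m} \<times> {0..n} = {}" by auto
  show "card ({..<m} \<times> {..<n} - {0..m} \<times> {0..n}) \<le> 4 * (m + n + 1)"
    unfolding empty by simp
qed (auto simp: quad_columns_def quad_rows_def intro: inv)

section \<open>The generalized aztec diamond\<close>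

definition aztec_cells :: "nat \<Rightarrow> nat \<Rightarrow> (nat \<times> nat) set" where
  "aztec_cells m n = {(x, y). 1 \<le> x \<and> x \<le> 2 * m \<and> 1 \<le> y \<and> y \<le> 2 * n \<and> odd (x + y)}"

lemma finite_aztec_cells: "finite (aztec_cells m n)"
  by (rule finite_subset[of _ "{1..2 * m} \<times> {1..2 * n}"]) (auto simp: aztec_cells_def)

text \<open>Each of the \<open>2 * m\<close> values of \<open>x\<close> admits the \<open>n\<close>
  values of \<open>y\<close> of opposite parity. The position of \<open>y\<close> among them,
  counted from 0, is \<open>(y - 1) div 2\<close> for either parity.\<close>

lemma card_aztec_cells: "card (aztec_cells m n) = 2 * m * n"
proof -
  let ?f = "\<lambda>(x, j). (x :: nat, if odd x then 2 * j + 2 else 2 * j + 1 :: nat)"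
  have "bij_betw ?f ({1..2 * m} \<times> {..<n}) (aztec_cells m n)"
    by (rule bij_betw_byWitness[where f' = "\<lambda>(x, y). (x, (y - 1) div 2)"])
      (auto simp: aztec_cells_def split: if_splits; presburger)+
  then show ?thesis
    using bij_betw_same_card by fastforce
qed

lemma aztec_entropy_constants:
  "\<exists>c. has_entropy_constant aztec_plane c \<and> has_entropy_constant aztec_cylinder c \<and>
    has_entropy_constant aztec_torus c"
proof -
  let ?V = "\<lambda>m n. {(x, y). 1 \<le> x \<and> x \<le> 2 * m + 1 \<and> 1 \<le> y \<and> y \<le> 2 * n + 1 \<and> odd (x + y)}"
  let ?B = "\<lambda>m n. {1, 2 * m + 1} \<times> {1..2 * n + 1} \<union> {1..2 * m + 1} \<times> {1, 2 * n + 1}"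
  let ?A = "\<lambda>(x, y) (x', y'). \<bar>int x - int x'\<bar> = 1 \<and> \<bar>int y - int y'\<bar> = 1"
  have "\<exists>c. has_entropy_constant (\<lambda>m n. \<lparr>verts = ?V m n, adj = ?A\<rparr>) c \<and>
    has_entropy_constant (\<lambda>m n. quotient_graph \<lparr>verts = ?V m n, adj = ?A\<rparr> (aztec_columns n)) c \<and>
    has_entropy_constant (\<lambda>m n. quotient_graph \<lparr>verts = ?V m n, adj = ?A\<rparr>
      (\<lambda>u v. aztec_columns n u v \<or> aztec_rows m u v)) c"
  \<comment> \<open>The coordinates \<open>2 * m + 1\<close> and \<open>2 * n + 1\<close> are
    dropped to get boxes with exactly \<open>2 * m * n\<close> vertices. Translations go by the even
    number \<open>2 * a\<close> and so respect the parity condition.\<close>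
  proof (rule lattice_entropy_constants[where k = 2 and C = 4 and W = aztec_cells and B = ?B
      and sx = "\<lambda>a. map_prod ((+) (2 * a)) ((+) 0)" and sy = "\<lambda>a. map_prod ((+) 0) ((+) (2 * a))"])
    show "aztec_cells (a + b) n \<subseteq> aztec_cells a n \<union> map_prod ((+) (2 * a)) ((+) 0) ` aztec_cells b n" for a b n
    proof clarify
      fix x y assume "(x, y) \<notin> map_prod ((+) (2 * a)) ((+) 0) ` aztec_cells b n"
        "(x, y) \<in> aztec_cells (a + b) n"
      then show "(x, y) \<in> aztec_cells a n"
        by (cases "x \<le> 2 * a") (auto simp: aztec_cells_def intro!: rev_image_eqI[of "(x - 2 * a, y)"])
    qed
    show "aztec_cells m (a + b) \<subseteq> aztec_cells m a \<union> map_prod ((+) 0) ((+) (2 * a)) ` aztec_cells m b" for m a b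
    proof clarify
      fix x y assume "(x, y) \<notin> map_prod ((+) 0) ((+) (2 * a)) ` aztec_cells m b"
        "(x, y) \<in> aztec_cells m (a + b)"
      then show "(x, y) \<in> aztec_cells m a"
        by (cases "y \<le> 2 * a") (auto simp: aztec_cells_def intro!: rev_image_eqI[of "(x, y - 2 * a)"])
    qed
    fix m n :: nat
    show B: "card (?B m n) \<le> 4 * (m + n + 1)"
      using card_frame_le[of 1 "2 * m + 1" "{1..2 * n + 1}" "{1..2 * m + 1}" 1 "2 * n + 1"] by simp
    have "card (?V m n - aztec_cells m n) \<le> card (?B m n)"
      by (rule card_mono) (auto simp: aztec_cells_def)
    with B show "card (?V m n - aztec_cells m n) \<le> 4 * (m + n + 1)" by linarith
    have empty: "aztec_cells m n - ?V m n = {}" by (auto simp: aztec_cells_def)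
    show "card (aztec_cells m n - ?V m n) \<le> 4 * (m + n + 1)"
      unfolding empty by simp
    show "finite (?V m n)"
      by (rule finite_subset[of _ "{1..2 * m + 1} \<times> {1..2 * n + 1}"]) auto
  qed (auto simp: finite_aztec_cells card_aztec_cells aztec_columns_def aztec_rows_def)
  then show ?thesis
    unfolding aztec_plane_def aztec_cylinder_def aztec_torus_def .
qed

section \<open>The 8.8.4 lattice\<close>

definition oct_cells :: "nat \<Rightarrow> nat \<Rightarrow> oct_vertex set" where
  "oct_cells m n = (\<Union>T\<in>{Up, Down, Left, Right}. case_prod T ` ({1..m} \<times> {1..n}))"

primrec oct_shift :: "nat \<Rightarrow> nat \<Rightarrow> oct_vertex \<Rightarrow> oct_vertex" where
  "oct_shift i j (Up a b) = Up (i + a) (j + b)"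
| "oct_shift i j (Down a b) = Down (i + a) (j + b)"
| "oct_shift i j (Left a b) = Left (i + a) (j + b)"
| "oct_shift i j (Right a b) = Right (i + a) (j + b)"

lemma finite_oct_cells: "finite (oct_cells m n)"
  by (simp add: oct_cells_def)

text \<open>Shows that the index set \<open>{Up, Down, Left, Right}\<close> of functions has four
  elements when the sum in \<open>card_oct_cells\<close> is evaluated.\<close>

lemma oct_constructors_distinct:
  "Up \<noteq> Down" "Up \<noteq> Left" "Up \<noteq> Right" "Down \<noteq> Left" "Down \<noteq> Right" "Left \<noteq> Right"
  by (metis oct_vertex.distinct)+

lemma card_oct_cells: "card (oct_cells m n) = 4 * m * n"
proof -
  have "card (oct_cells m n) = (\<Sum>T\<in>{Up, Down, Left, Right}. card (case_prod T ` ({1..m} \<times> {1..n})))"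
    unfolding oct_cells_def by (rule card_UN_disjoint) auto
  also have "\<dots> = (\<Sum>T\<in>{Up, Down, Left, Right}. m * n)"
    by (rule sum.cong) (auto simp: card_image inj_on_def)
  finally show ?thesis
    by (simp add: oct_constructors_distinct)
qed

lemma oct_cells_iff [simp]:
  "Up a b \<in> oct_cells m n \<longleftrightarrow> 1 \<le> a \<and> a \<le> m \<and> 1 \<le> b \<and> b \<le> n"
  "Down a b \<in> oct_cells m n \<longleftrightarrow> 1 \<le> a \<and> a \<le> m \<and> 1 \<le> b \<and> b \<le> n"
  "Left a b \<in> oct_cells m n \<longleftrightarrow> 1 \<le> a \<and> a \<le> m \<and> 1 \<le> b \<and> b \<le> n"
  "Right a b \<in> oct_cells m n \<longleftrightarrow> 1 \<le> a \<and> a \<le> m \<and> 1 \<le> b \<and> b \<le> n"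
  by (auto simp: oct_cells_def)

lemma oct_verts_iff [simp]:
  "Up a b \<in> oct_verts m n \<longleftrightarrow> 2 \<le> a \<and> a \<le> m \<and> 1 \<le> b \<and> b \<le> n"
  "Down a b \<in> oct_verts m n \<longleftrightarrow> 1 \<le> a \<and> a \<le> m - 1 \<and> 1 \<le> b \<and> b \<le> n"
  "Left a b \<in> oct_verts m n \<longleftrightarrow> 1 \<le> a \<and> a \<le> m \<and> 2 \<le> b \<and> b \<le> n"
  "Right a b \<in> oct_verts m n \<longleftrightarrow> 1 \<le> a \<and> a \<le> m \<and> 1 \<le> b \<and> b \<le> n - 1"
  by (auto simp: oct_verts_def)

lemma oct_verts_subset_cells: "oct_verts m n \<subseteq> oct_cells m n"
proof
  fix v assume "v \<in> oct_verts m n"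
  then show "v \<in> oct_cells m n" by (cases v) auto
qed

lemma oct_cells_add:
  "oct_cells (i + m) n \<subseteq> oct_cells i n \<union> oct_shift i 0 ` oct_cells m n"
  "oct_cells m (j + n) \<subseteq> oct_cells m j \<union> oct_shift 0 j ` oct_cells m n"
proof -
  \<comment> \<open>Membership in the union is recast so that \<open>v \<notin> S\<close> may be
    assumed and a preimage under the shift named.\<close>
  have split: "v \<in> S \<union> oct_shift i j ` T" if "v \<notin> S \<Longrightarrow> \<exists>w\<in>T. v = oct_shift i j w" for v S T i j
    using that by blast
  show "oct_cells (i + m) n \<subseteq> oct_cells i n \<union> oct_shift i 0 ` oct_cells m n"
  proof (rule subsetI, rule split)
    fix v assume v: "v \<in> oct_cells (i + m) n" "v \<notin> oct_cells i n"
    show "\<exists>w\<in>oct_cells m n. v = oct_shift i 0 w"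
    proof (cases v)
      \<comment> \<open>Outside the first box \<open>a\<close> exceeds \<open>i\<close>, so
        \<open>a - i\<close> is at least 1 and the subtraction does not truncate.\<close>
      case (Up a b) with v show ?thesis by (intro bexI[of _ "Up (a - i) b"]) auto
    next
      case (Down a b) with v show ?thesis by (intro bexI[of _ "Down (a - i) b"]) auto
    next
      case (Left a b) with v show ?thesis by (intro bexI[of _ "Left (a - i) b"]) auto
    next
      case (Right a b) with v show ?thesis by (intro bexI[of _ "Right (a - i) b"]) auto
    qed
  qed
  show "oct_cells m (j + n) \<subseteq> oct_cells m j \<union> oct_shift 0 j ` oct_cells m n"
  proof (rule subsetI, rule split)
    fix v assume v: "v \<in> oct_cells m (j + n)" "v \<notin> oct_cells m j"
    show "\<exists>w\<in>oct_cells m n. v = oct_shift 0 j w"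
    proof (cases v)
      case (Up a b) with v show ?thesis by (intro bexI[of _ "Up a (b - j)"]) auto
    next
      case (Down a b) with v show ?thesis by (intro bexI[of _ "Down a (b - j)"]) auto
    next
      case (Left a b) with v show ?thesis by (intro bexI[of _ "Left a (b - j)"]) auto
    next
      case (Right a b) with v show ?thesis by (intro bexI[of _ "Right a (b - j)"]) auto
    qed
  qed
qed

lemma oct_edge_shift: "oct_edge u v \<Longrightarrow> oct_edge (oct_shift i j u) (oct_shift i j v)"
  unfolding oct_edge_def by fastforce

lemma symclp_oct_edge_shift:
  "symclp oct_edge u v \<Longrightarrow> symclp oct_edge (oct_shift i j u) (oct_shift i j v)"
  by (auto simp: symclp_def oct_edge_shift)

text \<open>Gluing columns affects only up and down vertices of squares with \<open>b = 1\<close> or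
  \<open>b = n\<close>; gluing rows affects only left and right vertices of squares with
  \<open>a = 1\<close> or \<open>a = m\<close>. Some members, such as \<open>Up 1 1\<close>, are
  absent from the plane, which is harmless for an upper bound.\<close>

definition oct_frame :: "nat \<Rightarrow> nat \<Rightarrow> oct_vertex set" where
  "oct_frame m n =
     (\<Union>T\<in>{Up, Down}. case_prod T ` ({1..m} \<times> {1, n})) \<union>
     (\<Union>T\<in>{Left, Right}. case_prod T ` ({1, m} \<times> {1..n}))"

lemma finite_oct_frame: "finite (oct_frame m n)"
  by (simp add: oct_frame_def)

lemma card_image_doubleton_le:
  assumes "finite X"
  shows "card (f ` (X \<times> {a, b})) \<le> 2 * card X" "card (f ` ({a, b} \<times> X)) \<le> 2 * card X"
proof -
  have "card (X \<times> {a, b}) \<le> 2 * card X" "card ({a, b} \<times> X) \<le> 2 * card X"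
    by (simp_all add: card_cartesian_product card_insert_if)
  then show "card (f ` (X \<times> {a, b})) \<le> 2 * card X" "card (f ` ({a, b} \<times> X)) \<le> 2 * card X"
    using assms by (auto intro: order_trans[OF card_image_le])
qed

lemma card_oct_frame_le: "card (oct_frame m n) \<le> 4 * (m + n + 1)"
proof -
  have "card (oct_frame m n) \<le> card (case_prod Up ` ({1..m} \<times> {1, n}))
      + card (case_prod Down ` ({1..m} \<times> {1, n}))
      + (card (case_prod Left ` ({1, m} \<times> {1..n})) + card (case_prod Right ` ({1, m} \<times> {1..n})))"
    unfolding oct_frame_def
    by (simp only: UN_insert UN_empty Un_empty_right)
      (rule order_trans[OF card_Un_le add_mono[OF card_Un_le card_Un_le]])
  also have "\<dots> \<le> 2 * m + 2 * m + (2 * n + 2 * n)"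
    using card_image_doubleton_le[of "{1..m}"] card_image_doubleton_le[of "{1..n}"]
    by (intro add_mono) simp_all
  finally show ?thesis by simp
qed

lemma oct_frame_iff [simp]:
  "Up a b \<in> oct_frame m n \<longleftrightarrow> 1 \<le> a \<and> a \<le> m \<and> b \<in> {1, n}"
  "Down a b \<in> oct_frame m n \<longleftrightarrow> 1 \<le> a \<and> a \<le> m \<and> b \<in> {1, n}"
  "Left a b \<in> oct_frame m n \<longleftrightarrow> a \<in> {1, m} \<and> 1 \<le> b \<and> b \<le> n"
  "Right a b \<in> oct_frame m n \<longleftrightarrow> a \<in> {1, m} \<and> 1 \<le> b \<and> b \<le> n"
  by (auto simp: oct_frame_def image_iff)

text \<open>The plane lacks just the outward-pointing vertices of the squares along the four
  sides.\<close>

lemma card_oct_cells_diff_le: "card (oct_cells m n - oct_verts m n) \<le> 4 * (m + n + 1)"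
proof -
  \<comment> \<open>The degenerate doubletons such as \<open>{1, 1}\<close> fit
    \<open>card_image_doubleton_le\<close>; \<open>insert_absorb2\<close> is kept out of the
    simplifier below so that they do not collapse.\<close>
  let ?X = "(\<lambda>(b, a). Up a b) ` ({1..n} \<times> {1, 1}) \<union> (\<lambda>(b, a). Down a b) ` ({1..n} \<times> {m, m}) \<union>
    ((\<lambda>(a, b). Left a b) ` ({1..m} \<times> {1, 1}) \<union> (\<lambda>(a, b). Right a b) ` ({1..m} \<times> {n, n}))"
  have "oct_cells m n - oct_verts m n \<subseteq> ?X"
  proof
    fix v assume "v \<in> oct_cells m n - oct_verts m n"
    then show "v \<in> ?X" by (cases v) (auto simp: image_iff)
  qed
  then have "card (oct_cells m n - oct_verts m n) \<le> card ?X"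
    by (rule card_mono[rotated]) simp
  also have "\<dots> \<le> 2 * n + 2 * n + (2 * m + 2 * m)"
    using card_image_doubleton_le(1)[of "{1..m}"] card_image_doubleton_le(1)[of "{1..n}"]
    by (intro order_trans[OF card_Un_le] add_mono) (simp_all del: insert_absorb2)
  finally show ?thesis by simp
qed

lemma oct_entropy_constants:
  "\<exists>c. has_entropy_constant oct_plane c \<and> has_entropy_constant oct_cylinder c \<and>
    has_entropy_constant oct_torus c"
proof -
  have "\<exists>c. has_entropy_constant (\<lambda>m n. \<lparr>verts = oct_verts m n, adj = symclp oct_edge\<rparr>) c \<and>
    has_entropy_constant (\<lambda>m n. quotient_graph \<lparr>verts = oct_verts m n, adj = symclp oct_edge\<rparr>
      (oct_columns n)) c \<and>
    has_entropy_constant (\<lambda>m n. quotient_graph \<lparr>verts = oct_verts m n, adj = symclp oct_edge\<rparr>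
      (\<lambda>u v. oct_columns n u v \<or> oct_rows m u v)) c"
  \<comment> \<open>\<open>oct_cells\<close> gives every square all four vertices, even those
    missing at the boundary of the plane, so that boxes have exactly \<open>4 * m * n\<close>
    vertices and tile under \<open>oct_shift\<close>.\<close>
  proof (rule lattice_entropy_constants[where k = 4 and C = 4 and W = oct_cells and B = oct_frame
      and sx = "\<lambda>a. oct_shift a 0" and sy = "oct_shift 0"])
    fix m n :: nat
    have empty: "oct_verts m n - oct_cells m n = {}"
      using oct_verts_subset_cells by blast
    show "card (oct_verts m n - oct_cells m n) \<le> 4 * (m + n + 1)"
      unfolding empty by simp
    show "finite (oct_verts m n)"
      by (rule finite_subset[OF oct_verts_subset_cells finite_oct_cells])
  next
    fix m n u v
    assume "u \<in> oct_verts m n" "v \<in> oct_verts m n" "oct_columns n u v \<or> oct_rows m u v"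
    then show "u \<in> oct_frame m n \<and> v \<in> oct_frame m n"
      by (auto simp: oct_columns_def oct_rows_def)
  qed (auto simp only: finite_oct_cells card_oct_cells oct_cells_add symclp_oct_edge_shift
      finite_oct_frame card_oct_frame_le card_oct_cells_diff_le)
  then show ?thesis
    unfolding oct_plane_def oct_cylinder_def oct_torus_def .
qed

theorem mainTheorem3:
  shows "(\<exists>c. has_entropy_constant quad_plane c \<and>
              has_entropy_constant quad_cylinder c \<and>
              has_entropy_constant quad_torus c) \<and>
         (\<exists>c. has_entropy_constant crossed_plane c \<and>
              has_entropy_constant crossed_cylinder c \<and>
              has_entropy_constant crossed_torus c) \<and>
         (\<exists>c. has_entropy_constant aztec_plane c \<and>
              has_entropy_constant aztec_cylinder c \<and>
              has_entropy_constant aztec_torus c) \<and>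
         (\<exists>c. has_entropy_constant oct_plane c \<and>
              has_entropy_constant oct_cylinder c \<and>
              has_entropy_constant oct_torus c)"
proof (intro conjI)
  show "\<exists>c. has_entropy_constant quad_plane c \<and> has_entropy_constant quad_cylinder c \<and>
      has_entropy_constant quad_torus c"
    unfolding quad_plane_def quad_cylinder_def quad_torus_def
    \<comment> \<open>What remains is translation invariance: adjacency depends only on coordinate
      differences.\<close>
    by (rule quad_shape_entropy_constants) auto
  show "\<exists>c. has_entropy_constant crossed_plane c \<and> has_entropy_constant crossed_cylinder c \<and>
      has_entropy_constant crossed_torus c"
    unfolding crossed_plane_def crossed_cylinder_def crossed_torus_def
    by (rule quad_shape_entropy_constants) auto
qed (rule aztec_entropy_constants oct_entropy_constants)+

end
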